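(* (i) If $S=I_1\cup I_2$ where $I_1,I_2\subset\mathbb R$ are closed bounded intervals of positive length, then $e(S)>2/3$. (ii) If in addition $I_1$ and $I_2$ have the same length, then $e(S)>3/4$.
   Context: For a measurable $S\subset\mathbb R$ with non-empty interior and $x>0$, $\tau(S,x)=\min\{|T|:T\subset\mathbb R,\ T+S\supseteq[0,x]\}$; $\tau(S)=\lim_{x\to\infty}\tau(S,x)/x$ (which exists); $e(S)=1/(\tau(S)\lambda(S))$ with $\lambda$ Lebesgue measure. *)

theory Defs
  imports "HOL-Analysis.Analysis" "HOL-Library.Set_Algebras"
begin

text \<open>
  Only finite \<open>T\<close> are considered: if \<open>S\<close> has non-empty interior then, by compactness, finitely many
  translates of \<open>S\<close> cover \<open>{0..x}\<close>, so the minimum is attained at a finite set. The finiteness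
  condition is needed because \<^const>\<open>card\<close> is \<open>0\<close> on infinite sets.
\<close>

definition cover_num :: "real set \<Rightarrow> real \<Rightarrow> nat" where
  "cover_num S x = (LEAST n. \<exists>T. finite T \<and> card T = n \<and> {0..x} \<subseteq> T + S)"

definition cover_density :: "real set \<Rightarrow> real" where
  "cover_density S = Lim at_top (\<lambda>x. real (cover_num S x) / x)"

definition efficiency :: "real set \<Rightarrow> real" where
  "efficiency S = 1 / (cover_density S * measure lebesgue S)"

end

theory Submission
  imports Defs
begin

text \<open>
  Every covering of one interval of length \<open>L\<close> by \<open>n\<close> translates of \<open>S\<close> gives \<open>\<tau>(S) \<le> n / L\<close>, so it
  suffices to exhibit one efficient finite covering. Let the two intervals have lengths \<open>p\<close>, \<open>q\<close>, let
  \<open>s > p\<close> be the distance between their left endpoints, and put \<open>h = min p q\<close>. If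
  \<open>max p q > 2 h\<close>, a single translate covering an interval of length \<open>max p q\<close> is good enough.
  Otherwise take the translates by \<open>0, h, \<dots>, k h\<close>, where \<open>k\<close> is least such that the translates of
  the left interval reach the right one, i.e.\ \<open>k h + p \<ge> s\<close>. They cover an interval of length
  \<open>s + k h + q\<close>, and minimality of \<open>k\<close> gives \<open>s > p + (k - 1) h\<close>, which yields both bounds.
\<close>

section \<open>Finite coverings and the covering number\<close>

lemma cover_num_le:
  assumes "finite T" "{0..x} \<subseteq> T + S"
  shows "cover_num S x \<le> card T"
  unfolding cover_num_def by (rule Least_le) (use assms in blast)

lemma cover_num_attained:
  assumes "finite T" "{0..x} \<subseteq> T + S"
  obtains T' where "finite T'" "card T' = cover_num S x" "{0..x} \<subseteq> T' + S"
proof -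
  have "\<exists>T'. finite T' \<and> card T' = cover_num S x \<and> {0..x} \<subseteq> T' + S"
    unfolding cover_num_def by (rule LeastI_ex) (use assms in blast)
  with that show ?thesis by blast
qed

text \<open>Blocks of length \<open>L\<close> are glued end to end. Half-open intervals let the
  empty set serve for \<open>n = 0\<close>, so the count is exactly \<open>n * card T\<close>
  without a correction term.\<close>

lemma cover_multiple:
  fixes S :: "real set"
  assumes "finite T" "{u..u + L} \<subseteq> T + S" "L > 0"
  shows "\<exists>T'. finite T' \<and> card T' \<le> n * card T \<and> {0<..real n * L} \<subseteq> T' + S"
proof (induction n)
  case 0
  show ?case by (rule exI[of _ "{}"]) auto
next
  case (Suc n)
  then obtain T' where T': "finite T'" "card T' \<le> n * card T" "{0<..real n * L} \<subseteq> T' + S"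
    by blast
  let ?T = "T' \<union> (\<lambda>t. t + (real n * L - u)) ` T"
  have "card ?T \<le> card T' + card ((\<lambda>t. t + (real n * L - u)) ` T)"
    by (rule card_Un_le)
  also have "\<dots> \<le> n * card T + card T"
    using T'(2) card_image_le[OF assms(1), of "\<lambda>t. t + (real n * L - u)"] by linarith
  finally have "card ?T \<le> Suc n * card T" by simp
  moreover have "y \<in> ?T + S" if y: "y \<in> {0<..real (Suc n) * L}" for y
  proof (cases "y \<le> real n * L")
    case True
    then have "y \<in> T' + S" using T'(3) y by auto
    then show ?thesis by (auto simp: set_plus_def)
  next
    case False
    then have "y - (real n * L - u) \<in> {u..u + L}" using y by (auto simp: algebra_simps)
    then have "y - (real n * L - u) \<in> T + S" using assms(2) by blast
    then obtain t z where "t \<in> T" "z \<in> S" "y - (real n * L - u) = t + z"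
      by (rule set_plus_elim)
    then have "t + (real n * L - u) \<in> ?T" "y = (t + (real n * L - u)) + z" by auto
    with \<open>z \<in> S\<close> show ?thesis by (blast intro: set_plus_intro)
  qed
  ultimately show ?case using T'(1) assms(1) by (intro exI[of _ ?T]) blast
qed

lemma cover_interval:
  fixes S :: "real set"
  assumes "finite T" "{u..u + L} \<subseteq> T + S" "L > 0" "x > 0"
  obtains T' where "finite T'" "{0..x} \<subseteq> T' + S"
    "real (card T') \<le> (x / L + 2) * real (card T)"
proof -
  define n where "n = nat \<lceil>x / L\<rceil>"
  have "x / L > 0" using assms by simp
  then have n: "real n \<ge> x / L" "real n \<le> x / L + 1" unfolding n_def by linarith+
  from n(1) have nL: "x \<le> real n * L" using assms by (simp add: field_simps)
  obtain T1 where T1: "finite T1" "card T1 \<le> n * card T" "{0<..real n * L} \<subseteq> T1 + S"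
    using cover_multiple[OF assms(1-3)] by blast
  \<comment> \<open>The extra copy of \<open>T\<close> covers the missing endpoint \<open>0\<close>.
    Together with the rounding up in \<open>n\<close> it accounts for the \<open>2\<close> in the
    bound, which vanishes after division by \<open>x\<close>.\<close>
  let ?T = "T1 \<union> (\<lambda>t. t - u) ` T"
  have "u \<in> T + S" using assms by auto
  then obtain t z where tz: "t \<in> T" "z \<in> S" "u = t + z" by (auto simp: set_plus_def)
  then have "(t - u) + z \<in> ?T + S" by (intro set_plus_intro) auto
  then have "0 \<in> ?T + S" using tz by simp
  moreover have "T1 + S \<subseteq> ?T + S" by (auto simp: set_plus_def)
  ultimately have "{0..x} \<subseteq> ?T + S" using T1(3) nL
    by (auto simp: subset_iff less_le)
  moreover have "card ?T \<le> n * card T + card T"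
    using T1(2) card_Un_le[of T1 "(\<lambda>t. t - u) ` T"] card_image_le[OF assms(1), of "\<lambda>t. t - u"]
    by linarith
  then have "real (card ?T) \<le> real (n * card T + card T)" by (rule of_nat_mono)
  moreover have "\<dots> = (real n + 1) * real (card T)" by (simp add: algebra_simps)
  moreover have "\<dots> \<le> (x / L + 2) * real (card T)"
    using n(2) by (intro mult_right_mono) auto
  ultimately show ?thesis using T1(1) assms(1) by (intro that[of ?T]) auto
qed

section \<open>The covering density and its link to efficiency\<close>

text \<open>Subadditivity and translation invariance of Lebesgue measure; this keeps the density
  away from \<open>0\<close>.\<close>

lemma cover_num_lower_bound:
  fixes S :: "real set"
  assumes "finite T" "{0..x} \<subseteq> T + S" "x > 0" "S \<in> lmeasurable"
  shows "x \<le> real (cover_num S x) * measure lebesgue S"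
proof -
  obtain T' where T': "finite T'" "card T' = cover_num S x" "{0..x} \<subseteq> T' + S"
    using cover_num_attained[OF assms(1,2)] .
  have eq: "T' + S = (\<Union>t\<in>T'. (+) t ` S)" by (auto simp: set_plus_def)
  have meas: "(+) t ` S \<in> lmeasurable" for t using assms(4) by (rule measurable_translation)
  have "x = measure lebesgue {0..x}" using assms(3) by simp
  also have "\<dots> \<le> measure lebesgue (\<Union>t\<in>T'. (+) t ` S)"
    by (rule measure_mono_fmeasurable) (use T' eq meas in \<open>auto intro!: fmeasurable.finite_UN\<close>)
  also have "\<dots> \<le> (\<Sum>t\<in>T'. measure lebesgue ((+) t ` S))"
    by (rule measure_UNION_le) (use T' meas in \<open>auto simp: fmeasurable_def\<close>)
  also have "\<dots> = real (cover_num S x) * measure lebesgue S"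
    using T'(2) by (simp add: measure_translation)
  finally show ?thesis .
qed

text \<open>Fekete's argument: the limit defining the density is the infimum of \<open>\<tau>(S, x) / x\<close>.\<close>

lemma cover_density_bounds:
  fixes S :: "real set"
  assumes T: "finite T" "{u..u + L} \<subseteq> T + S" "L > 0" and S: "S \<in> lmeasurable"
  shows "cover_density S > 0" "cover_density S \<le> real (card T) / L"
proof -
  define f where "f x = real (cover_num S x) / x" for x
  define m where "m = measure lebesgue S"
  \<comment> \<open>The covering is arbitrary here because the bound serves both for
    \<open>T\<close> and for optimal coverings of \<open>{0..x}\<close>.\<close>
  have upper: "f x \<le> real (card T') / L' + 2 * real (card T') / x"
    if T': "finite T'" "{v..v + L'} \<subseteq> T' + S" "L' > 0" and x: "x > 0" for T' v L' x
  proof -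
    obtain T'' where "finite T''" "{0..x} \<subseteq> T'' + S"
      "real (card T'') \<le> (x / L' + 2) * real (card T')"
      using cover_interval[OF T' x] .
    then have "real (cover_num S x) \<le> (x / L' + 2) * real (card T')"
      using cover_num_le[of T'' x S] by linarith
    then have "f x \<le> (x / L' + 2) * real (card T') / x"
      unfolding f_def using x by (simp add: divide_right_mono)
    also have "\<dots> = real (card T') / L' + 2 * real (card T') / x"
      using T' x by (simp add: field_simps)
    finally show ?thesis .
  qed
  have lower: "x \<le> real (cover_num S x) * m" if "x > 0" for x
    unfolding m_def by (rule cover_interval[OF T that]) (rule cover_num_lower_bound[OF _ _ that S])
  have "m \<noteq> 0" using lower[of 1] by auto
  then have "m > 0" by (simp add: m_def zero_less_measure_iff)
  then have f_lower: "1 / m \<le> f x" if "x > 0" for x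
    using lower[OF that] that unfolding f_def by (simp add: field_simps)
  define g where "g = Inf (f ` {0<..})"
  have bdd: "bdd_below (f ` {0<..})" using f_lower by (auto intro!: bdd_belowI[of _ "1 / m"])
  have g_le: "g \<le> f x" if "x > 0" for x
    unfolding g_def using bdd that by (intro cInf_lower) auto
  have g_pos: "0 < g"
  proof -
    have "1 / m \<le> g" unfolding g_def using f_lower by (intro cInf_greatest) auto
    moreover have "0 < 1 / m" using \<open>m > 0\<close> by simp
    ultimately show ?thesis by linarith
  qed
  have eventually_small: "eventually (\<lambda>x. f x < e) at_top"
    if T': "finite T'" "{v..v + L'} \<subseteq> T' + S" "L' > 0" "real (card T') / L' < e" for T' v L' e
  proof -
    have "((\<lambda>x. real (card T') / L' + 2 * real (card T') / x) \<longlongrightarrow> real (card T') / L' + 0) at_top"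
      by (intro tendsto_intros real_tendsto_divide_at_top[OF tendsto_const filterlim_ident])
    then have "eventually (\<lambda>x. real (card T') / L' + 2 * real (card T') / x < e) at_top"
      using T'(4) by (intro order_tendstoD(2)[where y = "real (card T') / L' + 0"]) auto
    with eventually_gt_at_top[of 0] show ?thesis
      by eventually_elim (use upper[OF T'(1-3)] le_less_trans in blast)
  qed
  have lim: "(f \<longlongrightarrow> g) at_top"
  proof (rule order_tendstoI)
    fix e assume "e < g"
    show "eventually (\<lambda>x. e < f x) at_top"
      using eventually_gt_at_top[of 0]
      by eventually_elim (use \<open>e < g\<close> g_le less_le_trans in blast)
  next
    fix e assume "g < e"
    then obtain x where x: "x > 0" "f x < e"
      unfolding g_def by (subst (asm) cInf_less_iff) (use bdd in auto)
    \<comment> \<open>An optimal covering of this one interval has ratio \<open>f x < e\<close>, and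
      repeating it keeps \<open>f\<close> below \<open>e\<close> for all large arguments.\<close>
    obtain T1 where "finite T1" "{0..x} \<subseteq> T1 + S" using cover_interval[OF T x(1)] .
    then obtain T' where "finite T'" "card T' = cover_num S x" "{0..x} \<subseteq> T' + S"
      by (rule cover_num_attained)
    then show "eventually (\<lambda>x. f x < e) at_top"
      using x by (intro eventually_small[of T' 0 x]) (auto simp: f_def)
  qed
  then have eq: "cover_density S = g"
    unfolding cover_density_def f_def by (intro tendsto_Lim) auto
  show "cover_density S > 0" using eq g_pos by simp
  have "g \<le> real (card T) / L"
  proof (rule dense_ge)
    fix e assume "real (card T) / L < e"
    then have "eventually (\<lambda>x. f x < e) at_top" by (rule eventually_small[OF T])
    then have "eventually (\<lambda>x. f x \<le> e) at_top" by (rule eventually_mono) simp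
    then show "g \<le> e" using lim by (intro tendsto_upperbound) auto
  qed
  with eq show "cover_density S \<le> real (card T) / L" by simp
qed

text \<open>The last hypothesis says that \<open>real (card T) / L\<close>, an upper bound for the
  density, is below \<open>1 / (r * measure lebesgue S)\<close>. Positivity of the density permits
  the inversion, since \<open>1 / 0 = 0\<close>.\<close>

lemma efficiency_greaterI:
  fixes S :: "real set"
  assumes "finite T" "{u..u + L} \<subseteq> T + S" "L > 0" "S \<in> lmeasurable" "r > 0"
    and "measure lebesgue S > 0" "real (card T) * measure lebesgue S * r < L"
  shows "efficiency S > r"
proof -
  note b = cover_density_bounds[OF assms(1-4)]
  have "cover_density S * measure lebesgue S \<le> real (card T) / L * measure lebesgue S"
    using b(2) assms(6) by (intro mult_right_mono) auto
  also have "\<dots> < 1 / r" using assms by (simp add: field_simps)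
  finally show ?thesis
    unfolding efficiency_def using b(1) assms(5,6) by (simp add: field_simps)
qed

section \<open>Explicit coverings by two intervals\<close>

text \<open>A step of at most the interval's length leaves no gap between consecutive
  translates.\<close>

lemma interval_subset_progression_plus:
  fixes a b h :: real
  assumes "h \<le> b - a"
  shows "{a..b + real k * h} \<subseteq> (\<lambda>i. real i * h) ` {..k} + {a..b}"
proof (induction k)
  case 0
  show ?case by (auto simp: set_plus_def)
next
  case (Suc k)
  show ?case
  proof
    fix y assume y: "y \<in> {a..b + real (Suc k) * h}"
    show "y \<in> (\<lambda>i. real i * h) ` {..Suc k} + {a..b}"
    proof (cases "y \<le> b + real k * h")
      case True
      then have "y \<in> (\<lambda>i. real i * h) ` {..k} + {a..b}" using y Suc by auto
      then show ?thesis by (fastforce simp: set_plus_def)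
    next
      case False
      then have "y - real (Suc k) * h \<in> {a..b}" using y assms by (auto simp: algebra_simps)
      then have "real (Suc k) * h + (y - real (Suc k) * h) \<in> (\<lambda>i. real i * h) ` {..Suc k} + {a..b}"
        by (intro set_plus_intro imageI) auto
      then show ?thesis by simp
    qed
  qed
qed

lemma efficiency_two_intervals:
  fixes a b c d :: real
  assumes ab: "a < b" and cd: "c < d" and ac: "a \<le> c" and S: "S = {a..b} \<union> {c..d}"
  shows "efficiency S > 2 / 3 \<and> (b - a = d - c \<longrightarrow> efficiency S > 3 / 4)"
proof (cases "c \<le> b")
  case True
  \<comment> \<open>Here \<open>S\<close> is a single interval and covers itself, so every
    \<open>r < 1\<close> is beaten.\<close>
  then have S': "S = {a..max b d}" using ab cd ac unfolding S by auto
  have "efficiency S > r" if "0 < r" "r < 1" for r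
  proof (rule efficiency_greaterI[of "{0}" a "max b d - a"])
    have "(max b d - a) * r < (max b d - a) * 1"
      using that ab by (intro mult_strict_left_mono) auto
    then show "real (card {0::real}) * measure lebesgue S * r < max b d - a"
      using ab by (simp add: S' algebra_simps)
  qed (use that ab in \<open>auto simp: S' set_plus_def\<close>)
  from this[of "2 / 3"] this[of "3 / 4"] show ?thesis by simp
next
  case False
  define p q h where "p = b - a" and "q = d - c" and "h = min p q"
  have pos: "p > 0" "q > 0" "h > 0" using ab cd by (auto simp: p_def q_def h_def)
  have S_meas: "S \<in> lmeasurable" unfolding S by (intro fmeasurable.Un) auto
  have "measure lebesgue S = measure lebesgue {a..b} + measure lebesgue {c..d}"
    unfolding S using False by (intro measure_Un_AE) auto
  then have m: "measure lebesgue S = p + q" using ab cd by (simp add: p_def q_def)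
  define k where "k = nat \<lceil>(c - b) / h\<rceil>"
  have "(c - b) / h > 0" using False pos by simp
  \<comment> \<open>The gap \<open>c - b\<close> is positive, so at least one shift is needed; both
    bounds below rely on \<open>k \<ge> 1\<close>.\<close>
  then have k: "k \<ge> 1" "real k \<ge> (c - b) / h" "real k - 1 < (c - b) / h"
    unfolding k_def by linarith+
  from k(2,3) have reach: "c \<le> b + real k * h" and least: "b + (real k - 1) * h < c"
    using pos by (simp_all add: field_simps)
  define T where "T = (\<lambda>i. real i * h) ` {..k}"
  define L where "L = c - a + real k * h + q"
  have T: "finite T" "real (card T) \<le> real k + 1"
    using card_image_le[of "{..k}" "\<lambda>i. real i * h"] by (auto simp: T_def)
  have "{a..b + real k * h} \<subseteq> T + {a..b}" "{c..d + real k * h} \<subseteq> T + {c..d}"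
    unfolding T_def by (rule interval_subset_progression_plus, simp add: h_def p_def q_def)+
  moreover have "{a..a + L} \<subseteq> {a..b + real k * h} \<union> {c..d + real k * h}"
    using reach by (auto simp: L_def q_def)
  ultimately have cover: "{a..a + L} \<subseteq> T + S" unfolding S set_plus_def by blast
  have L_lower: "L > p + q + (2 * real k - 1) * h"
    using least by (simp add: L_def p_def algebra_simps)
  have "(2 * real k - 1) * h \<ge> 0" using k(1) pos by simp
  then have L_pos: "L > 0" using L_lower pos by linarith
  have eff: "efficiency S > r" if "r > 0" "(real k + 1) * (p + q) * r < L" for r
  proof (rule efficiency_greaterI[OF T(1) cover L_pos S_meas that(1)])
    show "measure lebesgue S > 0" using m pos by simp
    have "real (card T) * (p + q) * r \<le> (real k + 1) * (p + q) * r"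
      using T(2) pos that by (intro mult_right_mono) auto
    then show "real (card T) * measure lebesgue S * r < L" using that m by simp
  qed
  have one: "efficiency S > 2 / 3"
  proof (cases "max p q \<le> 2 * h")
    case True
    then have "p + q \<le> 3 * h" by (auto simp: h_def)
    \<comment> \<open>By \<open>L_lower\<close>, the condition
      \<open>(real k + 1) * (p + q) * (2 / 3) < L\<close> follows from exactly this
      inequality.\<close>
    then have "(2 * real k - 1) * (p + q) \<le> (2 * real k - 1) * (3 * h)"
      using k(1) by (intro mult_left_mono) auto
    then show ?thesis using L_lower by (intro eff) (auto simp: algebra_simps)
  next
    case False
    \<comment> \<open>The longer interval alone suffices: \<open>h < max p q / 2\<close> gives
      \<open>p + q < 3 / 2 * max p q\<close>.\<close>
    define u where "u = (if p \<ge> q then a else c)"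
    have "{u..u + max p q} \<subseteq> {0} + S"
      by (auto simp: u_def S p_def q_def max_def)
    moreover have "real (card {0::real}) * measure lebesgue S * (2 / 3) < max p q"
      using False pos by (auto simp: m h_def max_def min_def split: if_splits)
    ultimately show ?thesis
      using pos m by (intro efficiency_greaterI[of "{0}" u "max p q"] S_meas) auto
  qed
  moreover have "efficiency S > 3 / 4" if "b - a = d - c"
  proof (rule eff)
    have "p = h" "q = h" using that by (auto simp: p_def q_def h_def)
    \<comment> \<open>With \<open>p = q = h\<close> it remains to compare
      \<open>3 / 2 * (real k + 1) * h\<close> with \<open>(2 * real k + 1) * h\<close>; they agree
      at \<open>k = 1\<close>, and strictness comes from \<open>L_lower\<close>.\<close>
    moreover have "1 * h \<le> real k * h" using k(1) pos by (intro mult_right_mono) auto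
    ultimately show "(real k + 1) * (p + q) * (3 / 4) < L"
      using L_lower by (simp add: algebra_simps)
  qed simp
  ultimately show ?thesis by blast
qed

theorem theorem10p1:
  fixes a b c d :: real and S :: "real set"
  assumes "a < b" and "c < d" and "S = {a..b} \<union> {c..d}"
  shows "efficiency S > 2 / 3 \<and> (b - a = d - c \<longrightarrow> efficiency S > 3 / 4)"
proof (cases "a \<le> c")
  case True
  then show ?thesis using efficiency_two_intervals assms by blast
next
  case False
  \<comment> \<open>The two intervals exchange roles, so that the left one comes first.\<close>
  then have "efficiency S > 2 / 3 \<and> (d - c = b - a \<longrightarrow> efficiency S > 3 / 4)"
    using assms by (intro efficiency_two_intervals) auto
  then show ?thesis by metis
qed

end
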